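(* For all integers $k\ge3$, $1\le d\le k-1$, and $n\ge k$, $$f_d(k,n)\le f_0^{n/k}(k-d,n-d).$$
   Context: For an integer $k\ge1$, a $k$-graph ($k$-uniform hypergraph) is a pair $H=(V,E)$ with $V$ finite and $E\subseteq\binom{V}{k}$. A fractional matching in $H$ is a function $w:E\to[0,1]$ with $\sum_{e\ni v}w(e)\le 1$ for every $v\in V$; its size is $\sum_{e\in E}w(e)$, and $\nu^*(H)$ is the maximum size of a fractional matching. For $0\le d\le k-1$ and $S\in\binom{V}{d}$, $\deg_H(S)$ is the number of edges containing $S$, and $\delta_d(H)=\min_{S\in\binom Vd}\deg_H(S)$ (so $\delta_0(H)=|E|$). For integers $0\le d\le k-1$ and a real number $0\le s\le n/k$, $f_d^s(k,n)$ is the minimum $m$ such that every $n$-vertex $k$-graph $H$ with $\delta_d(H)\ge m$ satisfies $\nu^*(H)\ge s$. When $s=n/k$ the superscript is suppressed: $f_d(k,n)=f_d^{n/k}(k,n)$. Thus $f_0^{n/k}(k-d,n-d)$ is the minimum $m$ such that every $(k-d)$-graph on $n-d$ vertices with at least $m$ edges has $\nu^*\ge n/k$. *)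

theory Defs
  imports "HOL-Analysis.Analysis"
begin

definition kgraph :: "nat \<Rightarrow> 'a set \<Rightarrow> 'a set set \<Rightarrow> bool" where
  "kgraph k V E \<longleftrightarrow> finite V \<and> E \<subseteq> {e. e \<subseteq> V \<and> card e = k}"

text \<open>Weights are total functions; only their values on \<open>E\<close> matter.\<close>

definition fractional_matching :: "'a set \<Rightarrow> 'a set set \<Rightarrow> ('a set \<Rightarrow> real) \<Rightarrow> bool" where
  "fractional_matching V E w \<longleftrightarrow>
     (\<forall>e\<in>E. 0 \<le> w e \<and> w e \<le> 1) \<and> (\<forall>v\<in>V. (\<Sum>e | e \<in> E \<and> v \<in> e. w e) \<le> 1)"

text \<open>The maximum size of a fractional matching. It is written as a supremum, which is
  attained by compactness: see \<open>nu_star_attained\<close> below.\<close>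

definition nu_star :: "'a set \<Rightarrow> 'a set set \<Rightarrow> real" where
  "nu_star V E = Sup {(\<Sum>e\<in>E. w e) | w. fractional_matching V E w}"

definition hdeg :: "'a set set \<Rightarrow> 'a set \<Rightarrow> nat" where
  "hdeg E S = card {e \<in> E. S \<subseteq> e}"

definition min_deg :: "nat \<Rightarrow> 'a set \<Rightarrow> 'a set set \<Rightarrow> nat" where
  "min_deg d V E = Min (hdeg E ` {S. S \<subseteq> V \<and> card S = d})"

text \<open>Everything above is invariant under relabelling the vertices, so it is enough to let
  \<open>V\<close> range over the finite sets of natural numbers. For \<open>d \<le> n\<close> the minimum
  exists (see \<open>f_thr_spec\<close> below).\<close>

definition f_thr :: "nat \<Rightarrow> real \<Rightarrow> nat \<Rightarrow> nat \<Rightarrow> nat" where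
  "f_thr d s k n = (LEAST m. \<forall>(V :: nat set) E.
     kgraph k V E \<and> card V = n \<and> min_deg d V E \<ge> m \<longrightarrow> nu_star V E \<ge> s)"

abbreviation f_perf :: "nat \<Rightarrow> nat \<Rightarrow> nat \<Rightarrow> nat" where
  "f_perf d k n \<equiv> f_thr d (real n / real k) k n"

lemma kgraph_finite_edges:
  assumes "kgraph k V E"
  shows "finite E"
proof -
  have "E \<subseteq> Pow V" and "finite V" using assms by (auto simp: kgraph_def)
  then show ?thesis by (meson finite_Pow_iff finite_subset)
qed

lemma nu_star_attained:
  fixes V :: "'a set"
  assumes H: "kgraph k V E"
  obtains w where "fractional_matching V E w" and "(\<Sum>e\<in>E. w e) = nu_star V E"
    and "\<And>w'. fractional_matching V E w' \<Longrightarrow> (\<Sum>e\<in>E. w' e) \<le> (\<Sum>e\<in>E. w e)"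
proof -
  have fin: "finite E" using kgraph_finite_edges[OF H] .
  define B :: "('a set \<Rightarrow> real) set" where "B = PiE UNIV (\<lambda>_. {0..1})"
  define C :: "('a set \<Rightarrow> real) set"
    where "C = (\<Inter>v\<in>V. {w. (\<Sum>e | e \<in> E \<and> v \<in> e. w e) \<le> 1})"
  have cont: "continuous_on UNIV (\<lambda>w :: 'a set \<Rightarrow> real. \<Sum>e\<in>A. w e)" for A
    by (intro continuous_on_sum continuous_on_product_coordinates)
  have "compactin (product_topology (\<lambda>_ :: 'a set. euclidean :: real topology) UNIV) B"
    unfolding B_def by (simp add: compactin_PiE)
  then have "compact B"
    by (simp add: euclidean_product_topology)
  moreover have "closed C"
    unfolding C_def by (intro closed_INT ballI closed_Collect_le cont continuous_on_const)
  ultimately have "compact (B \<inter> C)" by (rule compact_Int_closed)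
  moreover have "(\<lambda>_. 0) \<in> B \<inter> C" by (auto simp: B_def C_def)
  ultimately obtain w where w: "w \<in> B \<inter> C"
    and mx: "\<And>u. u \<in> B \<inter> C \<Longrightarrow> (\<Sum>e\<in>E. u e) \<le> (\<Sum>e\<in>E. w e)"
    using continuous_attains_sup[of "B \<inter> C" "\<lambda>w. \<Sum>e\<in>E. w e"]
      continuous_on_subset[OF cont subset_UNIV] by blast
  have fw: "fractional_matching V E w"
    using w by (auto simp: fractional_matching_def B_def C_def PiE_iff)
  have le: "(\<Sum>e\<in>E. w' e) \<le> (\<Sum>e\<in>E. w e)" if w': "fractional_matching V E w'" for w'
  proof -
    define u where "u = (\<lambda>e. if e \<in> E then w' e else 0)"
    have "(\<Sum>e | e \<in> E \<and> v \<in> e. u e) = (\<Sum>e | e \<in> E \<and> v \<in> e. w' e)" for v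
      by (rule sum.cong) (auto simp: u_def)
    then have "u \<in> B \<inter> C"
      using w' by (auto simp: fractional_matching_def B_def C_def PiE_iff u_def)
    moreover have "(\<Sum>e\<in>E. u e) = (\<Sum>e\<in>E. w' e)"
      by (rule sum.cong) (auto simp: u_def)
    ultimately show ?thesis using mx by metis
  qed
  have "nu_star V E = (\<Sum>e\<in>E. w e)"
    unfolding nu_star_def by (rule cSup_eq_maximum) (use fw le in auto)
  with fw le that show ?thesis by metis
qed

lemma f_thr_spec:
  fixes V :: "nat set"
  assumes "d \<le> n" "kgraph k V E" "card V = n" "min_deg d V E \<ge> f_thr d s k n"
  shows "nu_star V E \<ge> s"
proof -
  let ?P = "\<lambda>m. \<forall>(V :: nat set) E.
     kgraph k V E \<and> card V = n \<and> min_deg d V E \<ge> m \<longrightarrow> nu_star V E \<ge> s"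
  have "min_deg d V E < Suc (2 ^ n)" if H: "kgraph k V E" "card V = n" for V :: "nat set" and E
  proof -
    have fV: "finite V" and EV: "E \<subseteq> Pow V" using H by (auto simp: kgraph_def)
    obtain S where S: "S \<subseteq> V" "card S = d"
      using obtain_subset_with_card_n[of d V] assms(1) H by metis
    have "finite {S. S \<subseteq> V \<and> card S = d}" using fV by simp
    then have "min_deg d V E \<le> hdeg E S"
      unfolding min_deg_def using S by (intro Min_le) auto
    also have "\<dots> \<le> card (Pow V)"
      unfolding hdeg_def using fV EV by (intro card_mono) auto
    finally show ?thesis using fV H by (simp add: card_Pow)
  qed
  then have "?P (Suc (2 ^ n))" by (metis linorder_not_le)
  then have "?P (f_thr d s k n)" unfolding f_thr_def by (rule LeastI)
  then show ?thesis using assms by blast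
qed

end

(* Suppose H has no perfect fractional matching. By duality it has a fractional vertex cover c of
   total weight W < n/k. Let S consist of d vertices of smallest weight and let a be the average
   weight on S, so that a <= W/n < 1/k. Then (c - a) / (1 - k a) is a fractional vertex cover of
   the link (k-d)-graph of S with total weight (W - n a) / (1 - k a) < n/k, whereas that link has
   at least min_deg d edges.

   The required instance of LP duality is obtained by least squares: among all edge weightings of
   total weight n/k take one minimising the sum of the squares of the vertex degrees x. Unless
   x = 1 identically, the first-order optimality condition makes a multiple of x the cover. *)
theory Submission
  imports Defs
begin

section \<open>Fractional covers and weak duality\<close>

definition fractional_cover :: "'a set \<Rightarrow> 'a set set \<Rightarrow> ('a \<Rightarrow> real) \<Rightarrow> bool" where
  "fractional_cover V E c \<longleftrightarrow> (\<forall>v\<in>V. 0 \<le> c v) \<and> (\<forall>e\<in>E. 1 \<le> (\<Sum>v\<in>e. c v))"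

text \<open>Double counting of weighted incidences between vertices and edges. It serves for covers,
  for total degrees (\<open>c\<close> constant 1) and for inner products of degree vectors.\<close>

lemma sum_incidence_swap:
  fixes w :: "'a set \<Rightarrow> real" and c :: "'a \<Rightarrow> real"
  assumes "finite V" "E \<subseteq> Pow V"
  shows "(\<Sum>e\<in>E. w e * (\<Sum>v\<in>e. c v)) = (\<Sum>v\<in>V. c v * (\<Sum>e | e \<in> E \<and> v \<in> e. w e))"
proof -
  have fE: "finite E" using assms by (meson finite_Pow_iff finite_subset)
  have "(\<Sum>e\<in>E. w e * (\<Sum>v\<in>e. c v)) = (\<Sum>e\<in>E. \<Sum>v | v \<in> V \<and> v \<in> e. w e * c v)"
  proof (rule sum.cong[OF refl])
    fix e assume "e \<in> E"
    then have "{v. v \<in> V \<and> v \<in> e} = e" using assms by auto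
    then show "w e * (\<Sum>v\<in>e. c v) = (\<Sum>v | v \<in> V \<and> v \<in> e. w e * c v)"
      by (simp add: sum_distrib_left)
  qed
  also have "\<dots> = (\<Sum>v\<in>V. \<Sum>e | e \<in> E \<and> v \<in> e. w e * c v)"
    by (rule sum.swap_restrict[OF fE assms(1)])
  also have "\<dots> = (\<Sum>v\<in>V. c v * (\<Sum>e | e \<in> E \<and> v \<in> e. w e))"
    by (simp add: sum_distrib_left mult.commute)
  finally show ?thesis .
qed

text \<open>Weak duality: an edge has cover weight at least 1, and a vertex has matching weight at
  most 1, so both bounds meet after swapping the sums.\<close>

lemma nu_star_le_cover:
  assumes H: "kgraph k V E" and c: "fractional_cover V E c"
  shows "nu_star V E \<le> (\<Sum>v\<in>V. c v)"
proof -
  obtain w where w: "fractional_matching V E w" "(\<Sum>e\<in>E. w e) = nu_star V E"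
    using nu_star_attained[OF H] by metis
  have "(\<Sum>e\<in>E. w e) \<le> (\<Sum>e\<in>E. w e * (\<Sum>v\<in>e. c v))"
  proof (rule sum_mono)
    fix e assume "e \<in> E"
    then show "w e \<le> w e * (\<Sum>v\<in>e. c v)"
      using c w mult_left_mono[of 1 "\<Sum>v\<in>e. c v" "w e"]
      by (auto simp: fractional_cover_def fractional_matching_def)
  qed
  also have "\<dots> = (\<Sum>v\<in>V. c v * (\<Sum>e | e \<in> E \<and> v \<in> e. w e))"
    using H by (intro sum_incidence_swap) (auto simp: kgraph_def)
  also have "\<dots> \<le> (\<Sum>v\<in>V. c v)"
    using c w by (intro sum_mono mult_left_le) (auto simp: fractional_cover_def fractional_matching_def)
  finally show ?thesis using w by simp
qed

section \<open>Strong duality by least squares\<close>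

lemma linear_coeff_nonneg:
  fixes D R :: real
  assumes "\<And>t. 0 < t \<Longrightarrow> t \<le> 1 \<Longrightarrow> 0 \<le> 2 * t * D + t\<^sup>2 * R"
  shows "0 \<le> D"
proof (rule ccontr)
  assume D: "\<not> 0 \<le> D"
  \<comment> \<open>If \<open>D\<close> were negative, this \<open>t\<close> keeps
    \<open>t * R\<close> at most \<open>- D\<close>, too small to offset
    \<open>2 * D\<close>.\<close>
  define t where "t = min 1 (- D / (\<bar>R\<bar> + 1))"
  have t: "0 < t" "t \<le> 1" using D by (simp_all add: t_def divide_less_0_iff)
  have "t \<le> - D / (\<bar>R\<bar> + 1)" unfolding t_def by (rule min.cobounded2)
  then have tR: "t * (\<bar>R\<bar> + 1) \<le> - D" by (subst (asm) pos_le_divide_eq) auto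
  have "0 \<le> t * (2 * D + t * R)"
    using assms[OF t] by (simp add: algebra_simps power2_eq_square)
  then have "0 \<le> 2 * D + t * R" using t(1) by (simp add: zero_le_mult_iff)
  moreover have "t * R \<le> t * (\<bar>R\<bar> + 1)" using t(1) by (intro mult_left_mono) auto
  ultimately show False using tR D by linarith
qed

text \<open>A closed hyperplane meets a cube that is compact by Tychonoff. Weights are total
  functions, so the bounds are imposed on all sets, not just on edges.\<close>

lemma fixed_size_weights_compact:
  fixes E :: "'a set set" and M :: real
  shows "compact {w. (\<forall>e. 0 \<le> w e \<and> w e \<le> M) \<and> (\<Sum>e\<in>E. w e) = M}"
proof -
  have "compactin (product_topology (\<lambda>_ :: 'a set. euclidean :: real topology) UNIV)
      (PiE UNIV (\<lambda>_. {0..M}))"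
    by (simp add: compactin_PiE)
  then have "compact (PiE UNIV (\<lambda>_ :: 'a set. {0..M}))"
    by (simp add: euclidean_product_topology)
  moreover have "closed {w :: 'a set \<Rightarrow> real. (\<Sum>e\<in>E. w e) = M}"
    by (intro closed_Collect_eq continuous_on_sum continuous_on_product_coordinates
        continuous_on_const)
  ultimately have "compact (PiE UNIV (\<lambda>_. {0..M}) \<inter> {w. (\<Sum>e\<in>E. w e) = M})"
    by (rule compact_Int_closed)
  moreover have "PiE UNIV (\<lambda>_. {0..M}) \<inter> {w. (\<Sum>e\<in>E. w e) = M}
      = {w. (\<forall>e. 0 \<le> w e \<and> w e \<le> M) \<and> (\<Sum>e\<in>E. w e) = M}"
    by (auto simp: PiE_iff)
  ultimately show ?thesis by simp
qed

text \<open>At the minimiser every edge has \<open>x\<close>-weight at least \<open>Q / M\<close>,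
  so \<open>M * x / Q\<close> is a cover. Its total weight is \<open>M * card V / Q\<close>, which
  is below \<open>M\<close> because \<open>Q\<close> exceeds \<open>card V\<close>.\<close>

lemma small_cover_if_not_perfect:
  fixes V :: "'a set"
  assumes H: "kgraph k V E" and k: "0 < k"
    and nu: "nu_star V E < real (card V) / real k"
  obtains c where "fractional_cover V E c" "(\<Sum>v\<in>V. c v) < real (card V) / real k"
proof (cases "E = {}")
  case True
  have "0 < real (card V) / real k"
    using nu_star_attained[OF H] True nu by (metis sum.empty)
  then show ?thesis using that[of "\<lambda>_. 0"] True by (simp add: fractional_cover_def)
next
  case False
  define M where "M = real (card V) / real k"
  have fV: "finite V" and EV: "E \<subseteq> Pow V" and unif: "\<And>e. e \<in> E \<Longrightarrow> card e = k"
    using H by (auto simp: kgraph_def)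
  have fE: "finite E" using kgraph_finite_edges[OF H] .
  have M0: "0 < M"
  proof -
    obtain e where "e \<in> E" using False by auto
    then have "k \<le> card V" using unif EV fV by (metis PowD card_mono subsetD)
    then show ?thesis using k by (simp add: M_def)
  qed
  define P where "P = {w :: 'a set \<Rightarrow> real. (\<forall>e. 0 \<le> w e \<and> w e \<le> M) \<and> (\<Sum>e\<in>E. w e) = M}"
  define dg where "dg w v = (\<Sum>e | e \<in> E \<and> v \<in> e. w e)" for w :: "'a set \<Rightarrow> real" and v
  \<comment> \<open>The extreme weighting with all weight on one edge; moving from the minimiser
    towards it yields the inequality for that edge.\<close>
  define peak where "peak e = (\<lambda>f. if f = e then M else 0)" for e :: "'a set"
  have peak: "peak e \<in> P" if "e \<in> E" for e
    using that fE M0 by (auto simp: P_def peak_def sum.delta)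
  have ne: "P \<noteq> {}" using peak False by blast
  have cont: "continuous_on P (\<lambda>w. \<Sum>v\<in>V. (dg w v)\<^sup>2)"
    unfolding dg_def
    by (intro continuous_on_sum continuous_on_power
        continuous_on_subset[OF continuous_on_product_coordinates subset_UNIV])
  obtain w where w: "w \<in> P"
    and mn: "\<And>u. u \<in> P \<Longrightarrow> (\<Sum>v\<in>V. (dg w v)\<^sup>2) \<le> (\<Sum>v\<in>V. (dg u v)\<^sup>2)"
    using continuous_attains_inf[OF _ ne cont] fixed_size_weights_compact[of M E]
    unfolding P_def by blast
  have w0: "\<And>e. 0 \<le> w e" and wM: "(\<Sum>e\<in>E. w e) = M" using w by (auto simp: P_def)
  define x where "x = dg w"
  define Q where "Q = (\<Sum>v\<in>V. (x v)\<^sup>2)"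
  have x0: "0 \<le> x v" for v by (simp add: x_def dg_def sum_nonneg w0)
  have sx: "(\<Sum>v\<in>V. x v) = card V"
  proof -
    have "(\<Sum>v\<in>V. x v) = (\<Sum>e\<in>E. w e * (\<Sum>v\<in>e. 1))"
      using sum_incidence_swap[OF fV EV, of w "\<lambda>_. 1"] by (simp add: x_def dg_def)
    also have "\<dots> = (\<Sum>e\<in>E. w e * k)" by (rule sum.cong) (simp_all add: unif)
    also have "\<dots> = card V" using k by (simp add: sum_distrib_right[symmetric] wM M_def)
    finally show ?thesis .
  qed
  \<comment> \<open>The degrees \<open>x\<close> have mean 1, so \<open>Q - card V\<close> is their
    sum of squared deviations from 1. If it vanished, \<open>w\<close> would be a fractional
    matching of size \<open>M\<close>.\<close>
  have Q: "card V < Q"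
  proof (rule ccontr)
    assume "\<not> card V < Q"
    moreover have "(\<Sum>v\<in>V. (x v - 1)\<^sup>2) = Q - card V"
      by (simp add: power2_diff sum.distrib sum_subtractf sum_distrib_left[symmetric] sx Q_def)
    ultimately have "(\<Sum>v\<in>V. (x v - 1)\<^sup>2) \<le> 0" by simp
    then have "(\<Sum>v\<in>V. (x v - 1)\<^sup>2) = 0" by (simp add: sum_nonneg order_antisym)
    then have x1: "x v = 1" if "v \<in> V" for v
      using that fV by (simp add: sum_nonneg_eq_0_iff)
    \<comment> \<open>Membership in \<open>P\<close> only bounds \<open>w e\<close> by
      \<open>M\<close>; the bound 1 comes from the degree of a vertex of \<open>e\<close>.\<close>
    have "w e \<le> 1" if e: "e \<in> E" for e
    proof -
      obtain v where v: "v \<in> e" using unif[OF e] k by (metis card.empty equals0I less_irrefl)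
      have "w e \<le> dg w v"
        unfolding dg_def by (rule member_le_sum) (use e v w0 fE in auto)
      then show ?thesis using x1[of v] v e EV by (force simp: x_def)
    qed
    then have "fractional_matching V E w"
      using w0 x1 by (auto simp: fractional_matching_def x_def dg_def)
    then have "M \<le> nu_star V E" using nu_star_attained[OF H] wM by metis
    then show False using nu by (simp add: M_def)
  qed
  \<comment> \<open>First-order optimality towards \<open>peak e\<close>: the inner product of
    \<open>x\<close> with \<open>y - x\<close> is nonnegative, and it equals the difference of the
    two sides.\<close>
  have opt: "Q \<le> M * (\<Sum>v\<in>e. x v)" if e: "e \<in> E" for e
  proof -
    define y where "y = dg (peak e)"
    have "(\<Sum>v\<in>V. x v * y v) = (\<Sum>f\<in>E. peak e f * (\<Sum>v\<in>f. x v))"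
      using sum_incidence_swap[OF fV EV, of "peak e" x] by (simp add: y_def dg_def)
    also have "\<dots> = (\<Sum>f\<in>E. if f = e then M * (\<Sum>v\<in>f. x v) else 0)"
      by (rule sum.cong) (auto simp: peak_def)
    also have "\<dots> = M * (\<Sum>v\<in>e. x v)" using e fE by (simp add: sum.delta)
    finally have xy: "(\<Sum>v\<in>V. x v * y v) = M * (\<Sum>v\<in>e. x v)" .
    have "0 \<le> (\<Sum>v\<in>V. x v * (y v - x v))"
    proof (rule linear_coeff_nonneg)
      fix t :: real assume t: "0 < t" "t \<le> 1"
      define u where "u f = (1 - t) * w f + t * peak e f" for f
      have "0 \<le> u f \<and> u f \<le> M" for f
        using t w peak[OF e] convex_bound_le[of "w f" M "peak e f" "1 - t" t]
        by (simp add: P_def u_def)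
      moreover have "(\<Sum>f\<in>E. u f) = M"
        using w peak[OF e]
        by (simp add: P_def u_def sum.distrib sum_distrib_left[symmetric])
           (simp add: algebra_simps)
      ultimately have "u \<in> P" by (simp add: P_def)
      then have "Q \<le> (\<Sum>v\<in>V. (dg u v)\<^sup>2)" using mn by (simp add: Q_def x_def)
      also have "\<dots> = (\<Sum>v\<in>V. (x v + t * (y v - x v))\<^sup>2)"
        by (simp add: dg_def u_def x_def y_def sum.distrib sum_subtractf sum_distrib_left[symmetric] algebra_simps)
      also have "\<dots> = Q + 2 * t * (\<Sum>v\<in>V. x v * (y v - x v)) + t\<^sup>2 * (\<Sum>v\<in>V. (y v - x v)\<^sup>2)"
        unfolding Q_def sum_distrib_left sum.distrib[symmetric]
        by (rule sum.cong) (auto simp: power2_eq_square algebra_simps)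
      finally show "0 \<le> 2 * t * (\<Sum>v\<in>V. x v * (y v - x v)) + t\<^sup>2 * (\<Sum>v\<in>V. (y v - x v)\<^sup>2)"
        by simp
    qed
    also have "\<dots> = M * (\<Sum>v\<in>e. x v) - Q"
      by (simp add: right_diff_distrib sum_subtractf xy Q_def power2_eq_square)
    finally show ?thesis by simp
  qed
  have Q0: "0 < Q" using Q by (meson le_less_trans of_nat_0_le_iff)
  define c where "c v = M * x v / Q" for v
  have sc: "(\<Sum>v\<in>A. c v) = M * (\<Sum>v\<in>A. x v) / Q" for A
    by (simp add: c_def sum_distrib_left sum_divide_distrib)
  have "fractional_cover V E c"
    unfolding fractional_cover_def
  proof (intro conjI ballI)
    show "0 \<le> c v" for v using M0 x0 Q0 by (simp add: c_def)
    show "1 \<le> (\<Sum>v\<in>e. c v)" if "e \<in> E" for e using opt[OF that] Q0 by (simp add: sc)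
  qed
  moreover have "(\<Sum>v\<in>V. c v) < M"
    using Q Q0 M0 by (simp add: sc sx divide_less_eq)
  ultimately show ?thesis using that by (simp add: M_def)
qed

text \<open>Greedy choice: repeatedly add a vertex of least weight among those remaining.\<close>

lemma obtain_smallest_subset:
  fixes c :: "'a \<Rightarrow> 'b::linorder"
  assumes "finite V" "d \<le> card V"
  obtains S where "S \<subseteq> V" "card S = d" "\<And>u v. u \<in> S \<Longrightarrow> v \<in> V - S \<Longrightarrow> c u \<le> c v"
proof -
  have "\<exists>S\<subseteq>V. card S = d \<and> (\<forall>u\<in>S. \<forall>v\<in>V - S. c u \<le> c v)"
    using assms(2)
  proof (induction d)
    case 0
    then show ?case by (intro exI[of _ "{}"]) auto
  next
    case (Suc d)
    then obtain S where S: "S \<subseteq> V" "card S = d" "\<forall>u\<in>S. \<forall>v\<in>V - S. c u \<le> c v" by auto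
    have fS: "finite S" using S assms finite_subset by blast
    have "V - S \<noteq> {}"
      using S Suc.prems fS by (metis Diff_eq_empty_iff not_less_eq_eq order_refl subset_antisym)
    then obtain s where s: "s \<in> V - S" "\<forall>v\<in>V - S. c s \<le> c v"
      using ex_min_if_finite[of "c ` (V - S)"] assms(1)
      by (metis arg_min_if_finite(1) arg_min_least finite_Diff)
    show ?case by (intro exI[of _ "insert s S"]) (use S s fS in auto)
  qed
  then show ?thesis using that by blast
qed

section \<open>Links and the transfer of covers\<close>

definition link :: "'a set set \<Rightarrow> 'a set \<Rightarrow> 'a set set" where
  "link E S = (\<lambda>e. e - S) ` {e \<in> E. S \<subseteq> e}"

lemma card_link: "card (link E S) = hdeg E S"
  unfolding link_def hdeg_def by (rule card_image) (auto simp: inj_on_def)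

lemma kgraph_link:
  assumes "kgraph k V E" "S \<subseteq> V"
  shows "kgraph (k - card S) (V - S) (link E S)"
proof -
  have "card (e - S) = k - card S" if "e \<in> E" "S \<subseteq> e" for e
    using that assms by (auto simp: kgraph_def intro!: card_Diff_subset finite_subset[of S V])
  then show ?thesis using assms by (auto simp: kgraph_def link_def)
qed

lemma min_deg_zero:
  assumes "finite V"
  shows "min_deg 0 V E = card E"
proof -
  have "{S. S \<subseteq> V \<and> card S = 0} = {{}}"
    using assms by (auto simp: finite_subset card_eq_0_iff)
  then show ?thesis by (simp add: min_deg_def hdeg_def)
qed

lemma min_deg_le_hdeg:
  assumes "finite V" "S \<subseteq> V"
  shows "min_deg (card S) V E \<le> hdeg E S"
  unfolding min_deg_def using assms by (intro Min_le) auto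

text \<open>An edge through \<open>S\<close> spends exactly \<open>card S * a\<close> on
  \<open>S\<close>. Lowering its other \<open>k - card S\<close> weights by \<open>a\<close>
  therefore leaves at least \<open>1 - k * a\<close>, which the denominator normalises to 1.\<close>

lemma fractional_cover_link:
  fixes c :: "'a \<Rightarrow> real"
  assumes H: "kgraph k V E" and S: "S \<subseteq> V" and c: "fractional_cover V E c"
    and mean: "(\<Sum>v\<in>S. c v) = real (card S) * a"
    and ge: "\<And>v. v \<in> V - S \<Longrightarrow> a \<le> c v" and a: "real k * a < 1"
  shows "fractional_cover (V - S) (link E S) (\<lambda>v. (c v - a) / (1 - real k * a))"
  unfolding fractional_cover_def
proof (intro conjI ballI)
  show "0 \<le> (c v - a) / (1 - real k * a)" if "v \<in> V - S" for v
    using ge[OF that] a by simp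
  fix f assume "f \<in> link E S"
  then obtain e where e: "e \<in> E" "S \<subseteq> e" "f = e - S" by (auto simp: link_def)
  have fe: "finite e" and ce: "card e = k"
    using H e by (auto simp: kgraph_def intro: finite_subset[of e V])
  have "card S \<le> k" using card_mono[OF fe e(2)] ce by simp
  then have cf: "real (card f) = real k - real (card S)"
    using e fe ce by (simp add: card_Diff_subset finite_subset of_nat_diff)
  have "1 \<le> (\<Sum>v\<in>e. c v)" using c e by (simp add: fractional_cover_def)
  also have "\<dots> = (\<Sum>v\<in>f. c v) + real (card S) * a"
    using sum.subset_diff[OF e(2) fe, of c] e(3) mean by simp
  finally have "1 - real k * a \<le> (\<Sum>v\<in>f. c v - a)"
    by (simp add: sum_subtractf cf algebra_simps)
  then show "1 \<le> (\<Sum>v\<in>f. (c v - a) / (1 - real k * a))"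
    using a by (simp add: sum_divide_distrib[symmetric])
qed

theorem proposition1p1:
  fixes k d n :: nat
  assumes "k \<ge> 3" and "1 \<le> d" and "d \<le> k - 1" and "n \<ge> k"
  shows "f_perf d k n \<le> f_thr 0 (real n / real k) (k - d) (n - d)"
proof -
  let ?m = "f_thr 0 (real n / real k) (k - d) (n - d)"
  \<comment> \<open>As \<open>f_perf d k n\<close> is a least element, it suffices that
    \<open>?m\<close> has its defining property.\<close>
  have "real n / real k \<le> nu_star V E"
    if H: "kgraph k V E" and n: "card V = n" and deg: "?m \<le> min_deg d V E" for V :: "nat set" and E
  proof (rule ccontr)
    assume "\<not> real n / real k \<le> nu_star V E"
    then obtain c where c: "fractional_cover V E c" and cl: "(\<Sum>v\<in>V. c v) < real n / real k"
      using small_cover_if_not_perfect[OF H] n assms by auto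
    have fV: "finite V" using H by (simp add: kgraph_def)
    have dn: "d \<le> card V" using assms n by simp
    obtain S where S: "S \<subseteq> V" "card S = d" and le: "\<And>u v. u \<in> S \<Longrightarrow> v \<in> V - S \<Longrightarrow> c u \<le> c v"
      using obtain_smallest_subset[OF fV dn] by metis
    have fS: "finite S" using S fV finite_subset by blast
    define a where "a = (\<Sum>v\<in>S. c v) / real d"
    have mean: "(\<Sum>v\<in>S. c v) = real (card S) * a" using assms S by (simp add: a_def)
    \<comment> \<open>Every weight in \<open>S\<close> is at most \<open>c v\<close>, hence so is
      their average.\<close>
    have ge: "a \<le> c v" if "v \<in> V - S" for v
      using sum_bounded_above[of S c "c v"] le that S assms
      by (simp add: a_def divide_le_eq mult.commute)
    have cVS: "real (card (V - S)) = real n - real d"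
      using S fS n dn by (simp add: card_Diff_subset of_nat_diff)
    have split: "(\<Sum>v\<in>V. c v) = (\<Sum>v\<in>V - S. c v) + real d * a"
      using sum.subset_diff[OF S(1) fV, of c] mean S by simp
    \<comment> \<open>Comparing \<open>a\<close> with the average over all of \<open>V\<close> gives
      \<open>k * a < 1\<close>, so the denominator is positive.\<close>
    have "real (card (V - S)) * a \<le> (\<Sum>v\<in>V - S. c v)"
      by (rule sum_bounded_below) (rule ge)
    then have "real n * a \<le> (\<Sum>v\<in>V. c v)" by (simp add: split cVS algebra_simps)
    with cl have "real n * a < real n / real k" by simp
    then have "real n * (real k * a) < real n * 1" using assms by (simp add: field_simps)
    then have a: "real k * a < 1" by (rule mult_left_less_imp_less) simp
    \<comment> \<open>The degree of \<open>S\<close> is the number of edges of its link, so the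
      threshold for \<open>d = 0\<close> applies to the link.\<close>
    have "?m \<le> min_deg 0 (V - S) (link E S)"
      using deg min_deg_le_hdeg[OF fV S(1), of E] fV S by (simp add: min_deg_zero card_link)
    moreover have L: "kgraph (k - d) (V - S) (link E S)"
      using kgraph_link[OF H S(1)] S by simp
    moreover have "card (V - S) = n - d" using S fS n by (simp add: card_Diff_subset)
    ultimately have "real n / real k \<le> nu_star (V - S) (link E S)"
      by (intro f_thr_spec) auto
    also have "\<dots> \<le> (\<Sum>v\<in>V - S. (c v - a) / (1 - real k * a))"
      by (intro nu_star_le_cover[OF L] fractional_cover_link[OF H S(1) c mean ge a])
    \<comment> \<open>Dropping \<open>S\<close> loses \<open>d * a\<close>, and the
      \<open>n - d\<close> other vertices lose \<open>a\<close> each: \<open>n * a\<close> in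
      total.\<close>
    also have "\<dots> = ((\<Sum>v\<in>V. c v) - real n * a) / (1 - real k * a)"
      by (simp add: sum_divide_distrib[symmetric] sum_subtractf cVS split algebra_simps)
    also have "\<dots> < (real n / real k - real n * a) / (1 - real k * a)"
      using cl a by (intro divide_strict_right_mono) auto
    also have "\<dots> = real n / real k" using a assms by (simp add: field_simps)
    finally show False by simp
  qed
  then show ?thesis unfolding f_thr_def[of d] by (intro Least_le) blast
qed

end
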